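(* For every $q\in[0,1)$ and every $\delta>0$ there exists a finite constant $C=C(q,\delta)$ such that for every integer $n\ge 1$, setting $T=\lceil \exp(C n^{1/3})\rceil$, there exists an estimator $\widehat{X}$ (a function of $T$ finite binary strings, with values in $\{0,1\}^n$) such that for every $x\in\{0,1\}^n$, $$\mathbb{P}_x\bigl[\widehat{X}(\widetilde{X}^1,\dots,\widetilde{X}^T)=x\bigr]\ \ge\ 1-\delta,$$ where under $\mathbb{P}_x$ the strings $\widetilde{X}^1,\dots,\widetilde{X}^T$ are i.i.d. outputs of the deletion channel with deletion probability $q$ applied to $x$.
   Context: Deletion channel with deletion probability $q$ (retention probability $p=1-q$): given an input string $x=(x_0,\dots,x_{n-1})\in\{0,1\}^n$, each bit $x_k$ is independently deleted with probability $q$ and retained with probability $p$; the output $\widetilde{X}$ is the (random-length, possibly empty) string obtained by concatenating the retained bits in their original order, with no gaps. *)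

theory Defs
  imports "HOL-Probability.Probability"
begin

text \<open>The mask marks retained positions by \<^const>\<open>True\<close>, hence the parameter \<open>1 - q\<close>.\<close>

definition deletion_channel :: "real \<Rightarrow> bool list \<Rightarrow> bool list pmf" where
  "deletion_channel q x =
     map_pmf (\<lambda>mask. map fst (filter snd (zip x mask)))
       (replicate_pmf (length x) (bernoulli_pmf (1 - q)))"

definition deletion_traces :: "real \<Rightarrow> nat \<Rightarrow> bool list \<Rightarrow> bool list list pmf" where
  "deletion_traces q T x = replicate_pmf T (deletion_channel q x)"

definition num_traces :: "real \<Rightarrow> nat \<Rightarrow> nat" where
  "num_traces C n = nat \<lceil>exp (C * real n powr (1 / 3))\<rceil>"

end

theory Submission
  imports Defs "HOL-Complex_Analysis.Conformal_Mappings"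
begin

text \<open>
  Let \<open>\<mu> j\<close> be the probability that the trace of \<open>x\<close> has a \<open>1\<close> at position \<open>j\<close>. Then
  \<open>\<Sum>j. \<mu> j * w ^ j = p * (\<Sum>k. x k * z ^ k)\<close> with \<open>z = p * w + q\<close>, so two strings are told apart by
  some \<open>\<mu> j\<close> as soon as the difference polynomial \<open>A\<close>, with coefficients in \<open>{-1, 0, 1}\<close>, is not too
  small at some \<open>z\<close> for which \<open>|w|\<close> hardly exceeds \<open>1\<close>.

  Such a \<open>z\<close> is found on the circle \<open>z = 1/4 + 3/4 * \<zeta>\<close>, \<open>|\<zeta>| = 1\<close>, which touches the unit circle
  at \<open>1\<close>. Assume \<open>|A 0| = 1\<close>, after division by a power of \<open>z\<close>. Since \<open>|A z| \<le> 1 / (1 - |z|)\<close> and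
  \<open>1 - |z|\<close> is of order \<open>|1 - \<zeta>|^2\<close>, the function \<open>G \<zeta> = A z * (1 - \<zeta>)^2\<close> is bounded on the circle by
  an absolute constant, and \<open>|G 0| \<ge> 2/3\<close>. The maximum principle for the product of the \<open>N\<close> rotations
  \<open>G (\<zeta> * exp (2 * pi * i * j / N))\<close> yields a point \<open>\<zeta>\<close> within \<open>2 * pi / N\<close> of \<open>1\<close> where \<open>|G|\<close> is at
  least \<open>16 ^ (-N)\<close>. There \<open>|w| ^ n\<close> is at most \<open>exp (c * n / N^2)\<close>, and \<open>N\<close> of order \<open>n powr (1/3)\<close>
  balances the two losses. Hoeffding's inequality for the \<open>n\<close> empirical bit frequencies concludes.
\<close>

section \<open>Bit probabilities of a trace\<close>

definition trace_bit_prob :: "real \<Rightarrow> bool list \<Rightarrow> nat \<Rightarrow> real" where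
  "trace_bit_prob q x j = measure_pmf.prob (deletion_channel q x) {y. j < length y \<and> y ! j}"

lemma deletion_channel_Nil: "deletion_channel q [] = return_pmf []"
  by (simp add: deletion_channel_def)

lemma deletion_channel_Cons:
  "deletion_channel q (b # x) =
     bernoulli_pmf (1 - q) \<bind>
       (\<lambda>k. if k then map_pmf ((#) b) (deletion_channel q x) else deletion_channel q x)"
  unfolding deletion_channel_def
  by (auto simp: map_bind_pmf map_pmf_def bind_assoc_pmf bind_return_pmf intro!: bind_pmf_cong)

lemma measure_bind_bernoulli_pmf:
  assumes "0 \<le> p" "p \<le> 1"
  shows "measure_pmf.prob (bernoulli_pmf p \<bind> f) A =
    p * measure_pmf.prob (f True) A + (1 - p) * measure_pmf.prob (f False) A"
proof -
  have "ennreal (measure_pmf.prob (bernoulli_pmf p \<bind> f) A) =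
      ennreal (p * measure_pmf.prob (f True) A + (1 - p) * measure_pmf.prob (f False) A)"
    using assms
    by (simp add: measure_pmf.emeasure_eq_measure[symmetric] ennreal_plus ennreal_mult mult.commute)
  then show ?thesis
    using assms by (subst (asm) ennreal_inj) auto
qed

lemma trace_bit_prob_Nil [simp]: "trace_bit_prob q [] j = 0"
  by (simp add: trace_bit_prob_def deletion_channel_Nil)

lemma trace_bit_prob_Cons:
  assumes "0 \<le> q" "q < 1"
  shows "trace_bit_prob q (b # x) j =
    (1 - q) * (case j of 0 \<Rightarrow> of_bool b | Suc i \<Rightarrow> trace_bit_prob q x i) + q * trace_bit_prob q x j"
  using assms
  by (cases j) (auto simp: trace_bit_prob_def deletion_channel_Cons measure_bind_bernoulli_pmf vimage_def)

lemma trace_bit_prob_eq_0: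
  assumes "0 \<le> q" "q < 1" "length x \<le> j"
  shows "trace_bit_prob q x j = 0"
  using assms(3)
proof (induction x arbitrary: j)
  case (Cons b x)
  then show ?case
    using assms(1,2) by (cases j) (auto simp: trace_bit_prob_Cons)
qed simp

text \<open>Induction on the string: keeping the first bit shifts the rest of the trace by one
  position, a factor \<open>(1 - q) * w\<close>, while deleting it leaves the rest in place, a
  factor \<open>q\<close>. Each preceding input bit thus contributes
  \<open>(1 - q) * w + q\<close>.\<close>

lemma trace_bit_prob_generating_function:
  fixes w :: complex
  assumes q: "0 \<le> q" "q < 1"
  shows "(\<Sum>j<length x. of_real (trace_bit_prob q x j) * w ^ j) =
    (1 - of_real q) * (\<Sum>k<length x. of_bool (x ! k) * ((1 - of_real q) * w + of_real q) ^ k)"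
proof (induction x)
  case (Cons b x)
  define S where "S = (\<Sum>j<length x. of_real (trace_bit_prob q x j) * w ^ j)"
  define R where "R = (\<Sum>k<length x. of_bool (x ! k) * ((1 - of_real q) * w + of_real q) ^ k)"
  have S': "S = of_real (trace_bit_prob q x 0) + (\<Sum>j<length x. of_real (trace_bit_prob q x (Suc j)) * w ^ Suc j)"
  proof -
    \<comment> \<open>The added term \<open>j = length x\<close> vanishes because a trace is never
      longer than its input; it makes room for the index shift.\<close>
    have "S = (\<Sum>j<Suc (length x). of_real (trace_bit_prob q x j) * w ^ j)"
      using q by (simp add: S_def trace_bit_prob_eq_0)
    then show ?thesis
      by (simp add: sum.lessThan_Suc_shift del: sum.lessThan_Suc)
  qed
  have "(\<Sum>j<length (b # x). of_real (trace_bit_prob q (b # x) j) * w ^ j) =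
      (1 - of_real q) * of_bool b + of_real q * of_real (trace_bit_prob q x 0)
      + (\<Sum>j<length x. of_real ((1 - q) * trace_bit_prob q x j + q * trace_bit_prob q x (Suc j)) * w ^ Suc j)"
    using q by (simp add: sum.lessThan_Suc_shift trace_bit_prob_Cons del: sum.lessThan_Suc)
  also have "\<dots> = (1 - of_real q) * of_bool b + (1 - of_real q) * w * S + of_real q * S"
    by (subst (2) S') (simp add: S_def sum.distrib sum_subtractf sum_distrib_left algebra_simps)
  also have "\<dots> = (1 - of_real q) * (of_bool b + ((1 - of_real q) * w + of_real q) * R)"
    unfolding Cons.IH[folded S_def R_def] by (simp add: algebra_simps)
  also have "of_bool b + ((1 - of_real q) * w + of_real q) * R =
      (\<Sum>k<length (b # x). of_bool ((b # x) ! k) * ((1 - of_real q) * w + of_real q) ^ k)"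
    by (simp add: R_def sum.lessThan_Suc_shift sum_distrib_left mult_ac del: sum.lessThan_Suc)
  finally show ?case .
qed simp

section \<open>Lower bounds near a boundary point\<close>

lemma ex_rotation_near_1:
  fixes \<zeta> :: complex
  assumes "norm \<zeta> = 1" "N \<ge> 1"
  shows "\<exists>j<N. norm (1 - \<zeta> * cis (2 * pi * real j / real N)) \<le> 2 * pi / real N"
proof -
  define \<phi> where "\<phi> = Arg \<zeta>"
  have \<zeta>: "\<zeta> = cis \<phi>"
    using assms(1) by (metis \<phi>_def cis_Arg norm_zero sgn_eq zero_neq_one div_by_1 of_real_1)
  \<comment> \<open>Rotating \<open>k\<close> times by \<open>2 * pi / N\<close> brings the angle
    \<phi> into the interval from \<open>- 2 * pi / N\<close> to \<open>0\<close>; reducing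
    \<open>k\<close> modulo \<open>N\<close> only drops full turns.\<close>
  define k where "k = \<lfloor>- \<phi> * real N / (2 * pi)\<rfloor>"
  define j where "j = nat (k mod int N)"
  have j: "int j = k mod int N" "j < N"
    using assms(2) by (auto simp: j_def nat_less_iff)
  have N: "real N > 0" using assms(2) by simp
  define t where "t = \<phi> + 2 * pi * real_of_int k / real N"
  have kk: "real_of_int k = real j + real N * real_of_int (k div int N)"
  proof -
    have "k = int j + int N * (k div int N)" using j by simp
    then show ?thesis by (metis of_int_add of_int_mult of_int_of_nat_eq)
  qed
  have "t = \<phi> + 2 * pi * real j / real N + 2 * pi * real_of_int (k div int N)"
    unfolding t_def kk using N by (simp add: field_simps)
  then have "cis t = cis \<phi> * cis (2 * pi * real j / real N) * cis (2 * pi * real_of_int (k div int N))"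
    by (simp only: cis_mult)
  then have eq: "\<zeta> * cis (2 * pi * real j / real N) = cis t"
    by (simp add: \<zeta> cis_multiple_2pi)
  have "real_of_int k \<le> - \<phi> * real N / (2 * pi)" "- \<phi> * real N / (2 * pi) < real_of_int k + 1"
    unfolding k_def by linarith+
  then have "t \<le> 0" "- (2 * pi / real N) < t"
    unfolding t_def using N by (auto simp: field_simps)
  then have "\<bar>t\<bar> \<le> 2 * pi / real N" by linarith
  moreover have "norm (1 - cis t) \<le> \<bar>t\<bar>"
    using dist_exp_i_1[of t] abs_sin_x_le_abs_x[of "t / 2"]
    by (simp add: cis_conv_exp norm_minus_commute)
  ultimately show ?thesis
    using j eq by auto
qed

lemma max_modulus_near_1:
  fixes G :: "complex \<Rightarrow> complex"
  assumes hol: "G holomorphic_on ball 0 1" and cont: "continuous_on (cball 0 1) G"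
    and M: "\<And>\<zeta>. norm \<zeta> = 1 \<Longrightarrow> norm (G \<zeta>) \<le> M" and N: "N \<ge> 1"
  shows "\<exists>\<zeta>. norm \<zeta> = 1 \<and> norm (1 - \<zeta>) \<le> 2 * pi / real N \<and>
    norm (G 0) ^ N \<le> norm (G \<zeta>) * M ^ (N - 1)"
proof -
  define r where "r j = cis (2 * pi * real j / real N)" for j
  define F where "F \<zeta> = (\<Prod>j<N. G (\<zeta> * r j))" for \<zeta>
  have r: "norm (r j) = 1" for j by (simp add: r_def)
  have "(\<lambda>\<zeta>. G (\<zeta> * r j)) holomorphic_on ball 0 1" for j
    by (rule holomorphic_on_compose_gen[unfolded o_def, OF _ hol])
       (auto intro!: holomorphic_intros simp: norm_mult r)
  then have holF: "F holomorphic_on ball 0 1"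
    unfolding F_def by (intro holomorphic_intros)
  have "continuous_on (cball 0 1) (\<lambda>\<zeta>. G (\<zeta> * r j))" for j
    by (rule continuous_on_compose2[OF cont])
       (auto intro!: continuous_intros simp: norm_mult r)
  then have contF: "continuous_on (cball 0 1) F"
    unfolding F_def by (intro continuous_intros)
  have "continuous_on (sphere 0 1) (\<lambda>\<zeta>. norm (F \<zeta>))"
    by (intro continuous_intros continuous_on_subset[OF contF]) auto
  moreover have "(1::complex) \<in> sphere 0 1" by simp
  ultimately obtain \<zeta> where \<zeta>: "\<zeta> \<in> sphere 0 1"
    and max: "\<And>z. z \<in> sphere 0 1 \<Longrightarrow> norm (F z) \<le> norm (F \<zeta>)"
    using continuous_attains_sup[of "sphere (0::complex) 1" "\<lambda>\<zeta>. norm (F \<zeta>)"]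
    by (metis compact_sphere empty_iff)
  have n\<zeta>: "norm \<zeta> = 1" using \<zeta> by simp
  have le: "norm (F 0) \<le> norm (F \<zeta>)"
    by (rule maximum_modulus_frontier[of F "cball 0 1"]) (use holF contF max in auto)
  obtain i where i: "i < N" "norm (1 - \<zeta> * r i) \<le> 2 * pi / real N"
    using ex_rotation_near_1[OF n\<zeta> N] unfolding r_def by blast
  \<comment> \<open>Only the factor whose argument lies near \<open>1\<close> is kept; the other
    \<open>N - 1\<close> have arguments on the unit circle and are bounded by
    \<open>M\<close>.\<close>
  have "norm (F \<zeta>) = norm (G (\<zeta> * r i)) * (\<Prod>j\<in>{..<N} - {i}. norm (G (\<zeta> * r j)))"
    unfolding F_def prod_norm[symmetric] using i by (intro prod.remove) auto
  also have "(\<Prod>j\<in>{..<N} - {i}. norm (G (\<zeta> * r j))) \<le> (\<Prod>j\<in>{..<N} - {i}. M)"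
    by (intro prod_mono) (auto intro!: M simp: norm_mult r n\<zeta>)
  also have "\<dots> = M ^ (N - 1)" using i by simp
  finally have "norm (F \<zeta>) \<le> norm (G (\<zeta> * r i)) * M ^ (N - 1)"
    by (simp add: mult_left_mono)
  moreover have "norm (F 0) = norm (G 0) ^ N"
    by (simp add: F_def norm_power)
  ultimately show ?thesis
    using le i by (intro exI[of _ "\<zeta> * r i"]) (auto simp: norm_mult r n\<zeta>)
qed

section \<open>Bounded-coefficient polynomials on the tangent circle\<close>

lemma norm_tangent_circle:
  fixes \<zeta> :: complex
  assumes "norm \<zeta> = 1"
  shows "(norm (1 / 4 + 3 / 4 * \<zeta>))\<^sup>2 = 1 - 3 / 16 * (norm (1 - \<zeta>))\<^sup>2"
proof -
  \<comment> \<open>This is the variance identity for the convex combination of \<open>1\<close> and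
    \<zeta> with weights \<open>1/4\<close> and \<open>3/4\<close>; their product is
    \<open>3/16\<close>.\<close>
  have "(norm (1 / 4 + 3 / 4 * \<zeta>))\<^sup>2 - (1 - 3 / 16 * (norm (1 - \<zeta>))\<^sup>2) = 3 / 4 * ((norm \<zeta>)\<^sup>2 - 1)"
    unfolding cmod_power2 by (simp add: power2_eq_square field_simps)
  then show ?thesis
    using assms by simp
qed

text \<open>Comparison with the geometric series. The product form avoids division and is trivial
  outside the unit disc.\<close>

lemma norm_poly_times_one_minus_le:
  fixes a :: "nat \<Rightarrow> complex"
  assumes a: "\<And>k. norm (a k) \<le> 1"
  shows "norm (\<Sum>k<n. a k * z ^ k) * (1 - norm z) \<le> 1"
proof -
  have "norm (\<Sum>k<n. a k * z ^ k) \<le> (\<Sum>k<n. norm z ^ k)"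
    by (rule sum_norm_le) (simp add: norm_mult norm_power mult_left_le_one_le a)
  show ?thesis
  proof (cases "norm z \<le> 1")
    case True
    then have "norm (\<Sum>k<n. a k * z ^ k) * (1 - norm z) \<le> (\<Sum>k<n. norm z ^ k) * (1 - norm z)"
      using \<open>norm (\<Sum>k<n. a k * z ^ k) \<le> (\<Sum>k<n. norm z ^ k)\<close> by (intro mult_right_mono) auto
    also have "\<dots> = 1 - norm z ^ n"
      using one_diff_power_eq[of "norm z" n] by (simp add: mult.commute)
    finally show ?thesis by (smt (verit) norm_ge_zero zero_le_power)
  next
    case False
    then show ?thesis
      by (smt (verit) mult_nonneg_nonpos norm_ge_zero)
  qed
qed

text \<open>Turns \<open>1 - t\<close>, the squared norm on the tangent circle, into an exponential.
  There \<open>t\<close> is at most \<open>3/4\<close>, exactly the range where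
  \<open>(1 - t) * (1 + 4 * t)\<close> is at least \<open>1\<close>.\<close>

lemma exp_le_one_minus:
  fixes t :: real
  assumes "0 \<le> t" "t \<le> 3 / 4"
  shows "exp (- (4 * t)) \<le> 1 - t"
proof -
  have "0 \<le> t * (3 - 4 * t)" using assms by simp
  then have "1 \<le> (1 - t) * (1 + 4 * t)" by (simp add: algebra_simps)
  also have "\<dots> \<le> (1 - t) * exp (4 * t)"
    using assms by (intro mult_left_mono exp_ge_add_one_self) auto
  finally show ?thesis
    by (simp add: exp_minus field_simps)
qed

text \<open>The polynomial is \<open>z ^ m * B z\<close> with a unimodular constant term in
  \<open>B\<close>. The maximum principle for \<open>B\<close> costs \<open>6 * N\<close> in the
  exponent; the factor \<open>z ^ m\<close>, with \<open>z\<close> close to the unit circle, costs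
  \<open>24 * n / N^2\<close>.\<close>

lemma unit_coefficient_polynomial_lower_bound:
  fixes a :: "nat \<Rightarrow> complex"
  assumes a: "\<And>k. norm (a k) \<le> 1" and m: "m < n" "norm (a m) = 1" "\<And>k. k < m \<Longrightarrow> a k = 0"
    and N: "N \<ge> 1"
  shows "\<exists>\<zeta>. norm \<zeta> = 1 \<and> norm (1 - \<zeta>) \<le> 2 * pi / real N \<and>
    exp (- (6 * real N + 24 * real n / (real N)\<^sup>2)) \<le> norm (\<Sum>k<n. a k * (1 / 4 + 3 / 4 * \<zeta>) ^ k)"
proof -
  obtain l where l: "n = m + Suc l"
    using m(1) less_imp_Suc_add by auto
  define B where "B z = (\<Sum>k<Suc l. a (k + m) * z ^ k)" for z
  have A: "(\<Sum>k<n. a k * z ^ k) = z ^ m * B z" for z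
  proof -
    have "(\<Sum>k<n. a k * z ^ k) = (\<Sum>k\<in>{m..<m + Suc l}. a k * z ^ k)"
      unfolding l by (rule sum.mono_neutral_right) (auto simp: m(3))
    also have "\<dots> = (\<Sum>k\<in>{0..<Suc l}. a (k + m) * z ^ (k + m))"
      using sum.shift_bounds_nat_ivl[of "\<lambda>k. a k * z ^ k" 0 m "Suc l"] by (simp add: add.commute)
    finally show ?thesis
      by (simp add: B_def sum_distrib_left power_add mult_ac atLeast0LessThan del: sum.lessThan_Suc)
  qed
  define G where "G \<zeta> = B (1 / 4 + 3 / 4 * \<zeta>) * (1 - \<zeta>)\<^sup>2" for \<zeta>
  have hol: "G holomorphic_on S" for S
    unfolding G_def B_def by (intro holomorphic_intros)
  have M: "norm (G \<zeta>) \<le> 32 / 3" if "norm \<zeta> = 1" for \<zeta>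
  proof -
    let ?z = "1 / 4 + 3 / 4 * \<zeta>"
    \<comment> \<open>Expanding the square gives \<open>1 - |z|^2 <= 2 * (1 - |z|)\<close>, which
      turns the factor \<open>3/16\<close> of the circle identity into \<open>32/3\<close>.\<close>
    have "(1 - norm ?z)\<^sup>2 \<ge> 0" by simp
    then have "(norm (1 - \<zeta>))\<^sup>2 \<le> 32 / 3 * (1 - norm ?z)"
      using norm_tangent_circle[OF that] by (simp add: power2_diff)
    from mult_left_mono[OF this norm_ge_zero[of "B ?z"]]
    have "norm (G \<zeta>) \<le> 32 / 3 * (norm (B ?z) * (1 - norm ?z))"
      by (simp only: G_def norm_mult norm_power mult_ac)
    also have "norm (B ?z) * (1 - norm ?z) \<le> 1"
      unfolding B_def by (rule norm_poly_times_one_minus_le) (rule a)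
    finally show ?thesis by simp
  qed
  have G0: "2 / 3 \<le> norm (G 0)"
  proof -
    \<comment> \<open>The centre \<zeta> \<open>= 0\<close> corresponds to \<open>z = 1/4\<close>,
      where the terms after \<open>a m\<close> sum to at most
      \<open>(1/4) / (1 - 1/4) = 1/3\<close>.\<close>
    define R where "R = (\<Sum>k<l. a (k + Suc m) * (1 / 4) ^ k)"
    have "norm R * (1 - norm (1 / 4 :: complex)) \<le> 1"
      unfolding R_def by (rule norm_poly_times_one_minus_le) (rule a)
    then have "norm (1 / 4 * R) \<le> 1 / 3" by (simp add: norm_mult)
    moreover have "G 0 = a m + 1 / 4 * R"
      by (simp add: G_def B_def R_def sum.lessThan_Suc_shift sum_distrib_left mult_ac del: sum.lessThan_Suc)
    ultimately show ?thesis
      using norm_diff_ineq[of "a m" "1 / 4 * R"] m(2) by simp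
  qed
  obtain \<zeta> where \<zeta>: "norm \<zeta> = 1" "norm (1 - \<zeta>) \<le> 2 * pi / real N"
    and G: "norm (G 0) ^ N \<le> norm (G \<zeta>) * (32 / 3) ^ (N - 1)"
    using max_modulus_near_1[OF hol holomorphic_on_imp_continuous_on[OF hol] M N] by blast
  let ?z = "1 / 4 + 3 / 4 * \<zeta>"
  define u where "u = norm (1 - \<zeta>)"
  have u: "0 \<le> u" "u \<le> 2" "u \<le> 8 / real N"
  proof -
    show "u \<le> 2"
      using norm_triangle_ineq4[of 1 \<zeta>] \<zeta>(1) by (simp add: u_def)
    have "2 * pi / real N \<le> 8 / real N"
      using pi_less_4 by (intro divide_right_mono) auto
    then show "u \<le> 8 / real N" using \<zeta>(2) by (simp add: u_def)
  qed (simp add: u_def)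
  have u2: "u\<^sup>2 \<le> 4" "u\<^sup>2 \<le> 64 / (real N)\<^sup>2"
    using power_mono[OF u(2,1), of 2] power_mono[OF u(3,1), of 2] by (simp_all add: power_divide)
  have "(2 / 3) ^ N \<le> norm (G \<zeta>) * (32 / 3 :: real) ^ N"
  proof -
    have "(2 / 3) ^ N \<le> norm (G 0) ^ N" using G0 by (intro power_mono) auto
    also note G
    also have "norm (G \<zeta>) * (32 / 3) ^ (N - 1) \<le> norm (G \<zeta>) * (32 / 3 :: real) ^ N"
      by (intro mult_left_mono power_increasing) auto
    finally show ?thesis .
  qed
  \<comment> \<open>The base \<open>1/16\<close> is the ratio of the lower bound \<open>2/3\<close>
    at the centre to the upper bound \<open>32/3\<close> on the circle.\<close>
  moreover have "(2 / 3) ^ N = (1 / 16) ^ N * (32 / 3 :: real) ^ N"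
    by (simp flip: power_mult_distrib)
  ultimately have "(1 / 16) ^ N * (32 / 3 :: real) ^ N \<le> norm (G \<zeta>) * (32 / 3) ^ N"
    by argo
  then have "(1 / 16) ^ N \<le> norm (G \<zeta>)"
    by (rule mult_right_le_imp_le) simp
  also have "\<dots> \<le> norm (B ?z) * 4"
    using u2(1) by (simp add: G_def norm_mult norm_power mult_left_mono u_def)
  finally have B: "(1 / 16) ^ N / 4 \<le> norm (B ?z)" by simp
  \<comment> \<open>Since \<open>N\<close> is at least \<open>1\<close>,
    \<open>4 * N + 2 <= 6 * N\<close>; the \<open>2\<close> absorbs the factor \<open>1/4\<close>
    coming from \<open>|1 -\<close>\<zeta>\<open>|^2 <= 4\<close>.\<close>
  have "exp (- (6 * real N)) \<le> exp (- 4) ^ N * exp (- 2 :: real)"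
    using N by (simp flip: exp_of_nat_mult exp_add)
  also have "\<dots> \<le> (1 / 16) ^ N * (1 / 4)"
  proof (intro mult_mono power_mono)
    have "2 \<le> exp (1 :: real)" using exp_ge_add_one_self[of 1] by simp
    then have "2 ^ 4 \<le> exp (1 :: real) ^ 4" "2 ^ 2 \<le> exp (1 :: real) ^ 2"
      by (intro power_mono; simp)+
    then show "exp (- 4) \<le> (1 / 16 :: real)" "exp (- 2) \<le> (1 / 4 :: real)"
      by (simp_all add: exp_minus field_simps flip: exp_of_nat_mult)
  qed auto
  finally have B': "exp (- (6 * real N)) \<le> norm (B ?z)" using B by simp
  have z: "exp (- (24 * real n / (real N)\<^sup>2)) \<le> norm ?z ^ m"
  proof -
    define t where "t = 3 / 16 * u\<^sup>2"
    have t: "0 \<le> t" "t \<le> 3 / 4" "t \<le> 12 / (real N)\<^sup>2"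
      using u2 by (auto simp: t_def)
    have "exp (- (2 * t)) ^ 2 \<le> (norm ?z)\<^sup>2"
      using exp_le_one_minus[OF t(1,2)] norm_tangent_circle[OF \<zeta>(1)]
      by (simp add: t_def u_def flip: exp_of_nat_mult)
    then have "exp (- (2 * t)) \<le> norm ?z"
      by (rule power2_le_imp_le) simp
    then have "exp (- (2 * t)) ^ m \<le> norm ?z ^ m"
      by (intro power_mono) auto
    moreover have "real m * (2 * t) \<le> real n * (2 * (12 / (real N)\<^sup>2))"
      using m(1) t by (intro mult_mono) auto
    then have "exp (- (24 * real n / (real N)\<^sup>2)) \<le> exp (- (2 * t)) ^ m"
      by (simp add: algebra_simps flip: exp_of_nat_mult)
    ultimately show ?thesis by linarith
  qed
  have "exp (- (6 * real N + 24 * real n / (real N)\<^sup>2)) \<le> norm ?z ^ m * norm (B ?z)"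
    using mult_mono[OF z B'] unfolding minus_add exp_add by (simp add: mult.commute)
  then show ?thesis
    using \<zeta> by (intro exI[of _ \<zeta>]) (simp add: A norm_mult norm_power)
qed

section \<open>From the polynomial to the bit probabilities\<close>

lemma norm_one_minus_scaled_le:
  fixes \<zeta> :: complex and s :: real
  assumes "norm \<zeta> = 1" "0 \<le> s"
  shows "norm (1 - of_real s * (1 - \<zeta>)) \<le> exp (s\<^sup>2 * (norm (1 - \<zeta>))\<^sup>2 / 2)"
proof (rule power2_le_imp_le)
  \<comment> \<open>The point runs on a circle of radius \<open>s\<close> touching the unit circle
    at \<open>1\<close>, so the excess of its norm over \<open>1\<close> is only of second order in
    \<open>|1 -\<close>\<zeta>\<open>|\<close>.\<close>
  have "(norm (1 - of_real s * (1 - \<zeta>)))\<^sup>2 =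
      1 + s\<^sup>2 * (norm (1 - \<zeta>))\<^sup>2 - s * (norm (1 - \<zeta>))\<^sup>2 + s * ((norm \<zeta>)\<^sup>2 - 1)"
    unfolding cmod_power2 by (simp add: power2_eq_square algebra_simps)
  also have "\<dots> \<le> 1 + s\<^sup>2 * (norm (1 - \<zeta>))\<^sup>2"
    using assms by simp
  also have "\<dots> \<le> exp (s\<^sup>2 * (norm (1 - \<zeta>))\<^sup>2)"
    by (rule exp_ge_add_one_self)
  finally show "(norm (1 - of_real s * (1 - \<zeta>)))\<^sup>2 \<le> (exp (s\<^sup>2 * (norm (1 - \<zeta>))\<^sup>2 / 2))\<^sup>2"
    by (simp flip: exp_of_nat_mult)
qed simp

text \<open>At the chosen point the generating functions differ by a definite amount, while each
  \<open>|w ^ j|\<close> is at most \<open>E\<close>. Among the \<open>n\<close> terms one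
  coefficient difference must be at least the lower bound divided by \<open>n * E\<close>.\<close>

lemma trace_bit_prob_separation:
  assumes q: "0 \<le> q" "q < 1" and x: "length x = n" "length y = n" "x \<noteq> y" and N: "N \<ge> 1"
  shows "\<exists>j<n. (1 - q) / real n *
      exp (- (6 * real N + (24 + 32 * (3 / (4 * (1 - q)))\<^sup>2) * (real n / (real N)\<^sup>2)))
    \<le> \<bar>trace_bit_prob q x j - trace_bit_prob q y j\<bar>"
proof -
  \<comment> \<open>Chosen with \<open>(1 - q) * s = 3/4\<close>, so that
    \<open>w = 1 - s * (1 -\<close>\<zeta>\<open>)\<close> is mapped by
    \<open>(1 - q) * w + q\<close> to the tangent-circle point.\<close>
  define s where "s = 3 / (4 * (1 - q))"
  define a :: "nat \<Rightarrow> complex" where "a k = of_bool (x ! k) - of_bool (y ! k)" for k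
  define m where "m = (LEAST k. k < n \<and> x ! k \<noteq> y ! k)"
  have "\<exists>k<n. x ! k \<noteq> y ! k" using x by (auto simp: list_eq_iff_nth_eq)
  then have m: "m < n" "x ! m \<noteq> y ! m"
    unfolding m_def using LeastI_ex[of "\<lambda>k. k < n \<and> x ! k \<noteq> y ! k"] by blast+
  have "a k = 0" if "k < m" for k
    using not_less_Least[OF that[unfolded m_def]] that m(1) by (auto simp: a_def)
  moreover have "norm (a k) \<le> 1" for k by (simp add: a_def)
  moreover have "norm (a m) = 1" using m(2) by (auto simp: a_def)
  ultimately obtain \<zeta> where \<zeta>: "norm \<zeta> = 1" "norm (1 - \<zeta>) \<le> 2 * pi / real N"
    and A: "exp (- (6 * real N + 24 * real n / (real N)\<^sup>2)) \<le> norm (\<Sum>k<n. a k * (1 / 4 + 3 / 4 * \<zeta>) ^ k)"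
    using unit_coefficient_polynomial_lower_bound[of a m n N] m(1) N by blast
  define w where "w = 1 - of_real s * (1 - \<zeta>)"
  define E where "E = exp (32 * s\<^sup>2 * (real n / (real N)\<^sup>2))"
  define d where "d j = trace_bit_prob q x j - trace_bit_prob q y j" for j
  have s: "0 \<le> s" using q by (simp add: s_def)
  have "(1 - q) * s = 3 / 4" using q by (simp add: s_def field_simps)
  then have s34: "of_real (1 - q) * (of_real s :: complex) = 3 / 4"
    by (metis of_real_mult of_real_divide of_real_numeral)
  have "(1 - of_real q) * w + of_real q = 1 - (of_real (1 - q) * of_real s) * (1 - \<zeta>)"
    by (simp add: w_def algebra_simps)
  then have w: "(1 - of_real q) * w + of_real q = 1 / 4 + 3 / 4 * \<zeta>"
    unfolding s34 by (simp add: field_simps)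
  have "(\<Sum>j<n. of_real (d j) * w ^ j) =
      (\<Sum>j<n. of_real (trace_bit_prob q x j) * w ^ j) - (\<Sum>j<n. of_real (trace_bit_prob q y j) * w ^ j)"
    by (simp add: d_def left_diff_distrib sum_subtractf)
  also have "\<dots> = (1 - of_real q) * ((\<Sum>k<n. of_bool (x ! k) * (1 / 4 + 3 / 4 * \<zeta>) ^ k)
      - (\<Sum>k<n. of_bool (y ! k) * (1 / 4 + 3 / 4 * \<zeta>) ^ k))"
    unfolding right_diff_distrib
      trace_bit_prob_generating_function[OF q, of x w, unfolded w x]
      trace_bit_prob_generating_function[OF q, of y w, unfolded w x] ..
  also have "\<dots> = (1 - of_real q) * (\<Sum>k<n. a k * (1 / 4 + 3 / 4 * \<zeta>) ^ k)"
    by (simp only: a_def left_diff_distrib sum_subtractf)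
  also have "1 - of_real q = (of_real (1 - q) :: complex)"
    by simp
  finally have "norm (\<Sum>j<n. of_real (d j) * w ^ j) = (1 - q) * norm (\<Sum>k<n. a k * (1 / 4 + 3 / 4 * \<zeta>) ^ k)"
    using q by (simp add: norm_mult del: of_real_diff)
  then have lower: "(1 - q) * exp (- (6 * real N + 24 * real n / (real N)\<^sup>2)) \<le> norm (\<Sum>j<n. of_real (d j) * w ^ j)"
    using A q by (simp add: mult_left_mono)
  have wE: "norm w ^ j \<le> E" if "j < n" for j
  proof -
    have "2 * pi / real N \<le> 8 / real N"
      using pi_less_4 by (intro divide_right_mono) auto
    then have "(norm (1 - \<zeta>))\<^sup>2 \<le> (8 / real N)\<^sup>2"
      using \<zeta>(2) by (intro power_mono) auto
    from mult_left_mono[OF this, of "s\<^sup>2"]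
    have "s\<^sup>2 * (norm (1 - \<zeta>))\<^sup>2 / 2 \<le> 32 * s\<^sup>2 / (real N)\<^sup>2"
      by (simp add: power_divide mult.commute)
    then have "norm w \<le> exp (32 * s\<^sup>2 / (real N)\<^sup>2)"
      using norm_one_minus_scaled_le[OF \<zeta>(1) s] unfolding w_def
      by (meson exp_le_cancel_iff order_trans)
    then have "norm w ^ j \<le> exp (32 * s\<^sup>2 / (real N)\<^sup>2) ^ j"
      by (intro power_mono) auto
    also have "\<dots> \<le> exp (32 * s\<^sup>2 / (real N)\<^sup>2) ^ n"
      using that by (intro power_increasing) auto
    also have "\<dots> = E"
      by (simp add: E_def mult_ac flip: exp_of_nat_mult)
    finally show ?thesis .
  qed
  have En: "(1 - q) / real n * exp (- (6 * real N + (24 + 32 * s\<^sup>2) * (real n / (real N)\<^sup>2))) * E * real n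
      = (1 - q) * exp (- (6 * real N + 24 * real n / (real N)\<^sup>2))"
  proof -
    have "exp (- (6 * real N + (24 + 32 * s\<^sup>2) * (real n / (real N)\<^sup>2))) * E
        = exp (- (6 * real N + 24 * real n / (real N)\<^sup>2))"
      by (simp add: E_def algebra_simps flip: exp_add)
    then show ?thesis using m(1) by simp
  qed
  show ?thesis
  proof (rule ccontr)
    assume "\<not> ?thesis"
    then have small: "\<bar>d j\<bar> < (1 - q) / real n * exp (- (6 * real N + (24 + 32 * s\<^sup>2) * (real n / (real N)\<^sup>2)))"
      (is "_ < ?\<epsilon>") if "j < n" for j
      using that by (auto simp: d_def s_def not_le)
    have E0: "E > 0" by (simp add: E_def)
    have "norm (\<Sum>j<n. of_real (d j) * w ^ j) \<le> (\<Sum>j<n. \<bar>d j\<bar> * E)"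
      by (rule sum_norm_le) (auto simp: norm_mult norm_power intro!: mult_left_mono wE)
    also have "\<dots> < (\<Sum>j<n. ?\<epsilon> * E)"
      using m(1) E0 small by (intro sum_strict_mono mult_strict_right_mono) auto
    also have "\<dots> = ?\<epsilon> * E * real n" by simp
    finally show False
      using lower unfolding En by linarith
  qed
qed

section \<open>Empirical frequencies\<close>

lemma map_replicate_pmf: "map_pmf (map f) (replicate_pmf n p) = replicate_pmf n (map_pmf f p)"
proof (induction n)
  case (Suc n)
  show ?case
    by (simp add: map_bind_pmf bind_map_pmf flip: Suc.IH)
qed simp

lemma map_pmf_bool_eq_bernoulli_pmf: "map_pmf B P = bernoulli_pmf (measure_pmf.prob P {y. B y})"
proof (rule pmf_eqI)
  fix b
  have "measure_pmf.prob P {y. \<not> B y} = 1 - measure_pmf.prob P {y. B y}"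
    using measure_pmf.prob_compl[of "{y. B y}" P] by (simp add: Compl_eq_Diff_UNIV[symmetric] Collect_neg_eq)
  then show "pmf (map_pmf B P) b = pmf (bernoulli_pmf (measure_pmf.prob P {y. B y})) b"
    by (cases b) (simp_all add: pmf_map vimage_def)
qed

text \<open>The number of samples satisfying \<open>B\<close> is binomial, so Hoeffding's bound for
  the binomial distribution applies.\<close>

lemma replicate_pmf_frequency_tail:
  assumes "T > 0" "\<epsilon> \<ge> 0"
  shows "measure_pmf.prob (replicate_pmf T P)
      {ys. \<epsilon> \<le> \<bar>real (length (filter B ys)) / real T - measure_pmf.prob P {y. B y}\<bar>}
    \<le> 2 * exp (- (2 * real T * \<epsilon>\<^sup>2))"
proof -
  define p where "p = measure_pmf.prob P {y. B y}"
  interpret binomial_distribution T p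
    by unfold_locales (simp add: p_def)
  have "binomial_pmf T p = map_pmf (length \<circ> filter id) (map_pmf (map B) (replicate_pmf T P))"
    by (subst binomial_pmf_altdef)
       (simp_all add: p map_replicate_pmf map_pmf_bool_eq_bernoulli_pmf p_def del: o_apply)
  also have "\<dots> = map_pmf (\<lambda>ys. length (filter B ys)) (replicate_pmf T P)"
    by (simp add: pmf.map_comp o_def filter_map)
  finally show ?thesis
    using prob_abs_ge'[OF assms] by (simp add: vimage_def p_def)
qed

section \<open>The estimator and the number of traces\<close>

theorem theorem1p1:
  fixes q \<delta> :: real
  assumes "0 \<le> q" and "q < 1" and "\<delta> > 0"
  shows "\<exists>C::real. \<forall>n::nat. n \<ge> 1 \<longrightarrow>
    (\<exists>X :: bool list list \<Rightarrow> bool list.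
       (\<forall>ys. length ys = num_traces C n \<longrightarrow> length (X ys) = n) \<and>
       (\<forall>x. length x = n \<longrightarrow>
          measure_pmf.prob (deletion_traces q (num_traces C n) x) {ys. X ys = x} \<ge> 1 - \<delta>))"
proof -
  \<comment> \<open>With \<open>r = n powr (1/3)\<close> and \<open>N <= 2 * r\<close>, the
    separation exponent is at most \<open>(12 + 24 + 32 * s) * r\<close>, where \<open>s\<close> is
    the square in \<open>K\<close>. In \<open>C\<close>, \<open>2 * K\<close> pays for the square of
    the separation, \<open>9\<close> for \<open>n ^ 3 = r ^ 9\<close>, and \<open>D\<close> for
    \<delta> and \<open>(1 - q)^2\<close>.\<close>
  define K where "K = 36 + 32 * (3 / (4 * (1 - q)))\<^sup>2"
  define D where "D = 4 / (\<delta> * (1 - q)\<^sup>2)"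
  define C where "C = 2 * K + 9 + D"
  have D: "D \<ge> 0" using assms by (simp add: D_def)
  have "\<exists>X :: bool list list \<Rightarrow> bool list.
       (\<forall>ys. length ys = num_traces C n \<longrightarrow> length (X ys) = n) \<and>
       (\<forall>x. length x = n \<longrightarrow>
          measure_pmf.prob (deletion_traces q (num_traces C n) x) {ys. X ys = x} \<ge> 1 - \<delta>)"
    if n: "n \<ge> 1" for n :: nat
  proof -
    define r where "r = real n powr (1 / 3)"
    define N where "N = nat \<lceil>r\<rceil>"
    define T where "T = num_traces C n"
    define \<epsilon> where "\<epsilon> = (1 - q) / real n * exp (- (K * r))"
    have r: "r \<ge> 1" using n by (simp add: r_def ge_one_powr_ge_zero)
    have r3: "real n = r ^ 3"
      using n by (simp add: r_def powr_power)
    have N: "N \<ge> 1" "r \<le> real N" "real N \<le> 2 * r"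
      using r unfolding N_def by linarith+
    have "real n / (real N)\<^sup>2 \<le> real n / r\<^sup>2"
      using N r by (intro divide_left_mono power_mono mult_pos_pos) auto
    also have "\<dots> = r" using r by (simp add: r3 power2_eq_square power3_eq_cube)
    finally have nN: "real n / (real N)\<^sup>2 \<le> r" .
    have \<epsilon>: "\<epsilon> > 0" using assms n by (simp add: \<epsilon>_def)
    have sep: "\<exists>j<n. \<epsilon> \<le> \<bar>trace_bit_prob q x j - trace_bit_prob q y j\<bar>"
      if "length x = n" "length y = n" "x \<noteq> y" for x y
    proof -
      define s where "s = (3 / (4 * (1 - q)))\<^sup>2"
      have "(24 + 32 * s) * (real n / (real N)\<^sup>2) \<le> (24 + 32 * s) * r"
        using nN by (intro mult_left_mono) (auto simp: s_def)
      then have "6 * real N + (24 + 32 * s) * (real n / (real N)\<^sup>2) \<le> K * r"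
        using N unfolding K_def s_def[symmetric] by (simp add: algebra_simps)
      then have "\<epsilon> \<le> (1 - q) / real n * exp (- (6 * real N + (24 + 32 * s) * (real n / (real N)\<^sup>2)))"
        unfolding \<epsilon>_def using assms by (intro mult_left_mono) auto
      then show ?thesis
        using trace_bit_prob_separation[OF assms(1,2) that N(1)] unfolding s_def
        by (meson order_trans)
    qed
    have T: "exp (C * r) \<le> real T" unfolding T_def num_traces_def r_def by linarith
    then have T0: "T > 0" using exp_gt_zero[of "C * r"] by (intro gr0I) auto
    have fail: "real n * (2 * exp (- (2 * real T * (\<epsilon> / 2)\<^sup>2))) \<le> \<delta>"
    proof -
      have "D \<le> exp D" using exp_ge_add_one_self[of D] by linarith
      also have "\<dots> \<le> exp (D * r)" using D r by (simp add: mult_le_cancel_left1)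
      finally have D': "D \<le> exp (D * r)" .
      have "r \<le> exp r" using exp_ge_add_one_self[of r] by linarith
      then have "r ^ 9 \<le> exp r ^ 9" using r by (intro power_mono) auto
      then have n3: "real n ^ 3 \<le> exp (9 * r)"
        by (simp add: r3 flip: power_mult exp_of_nat_mult)
      have "exp (2 * K * r) * real n ^ 3 * D \<le> exp (2 * K * r) * exp (9 * r) * exp (D * r)"
        using n3 D' D by (intro mult_mono) auto
      also have "\<dots> = exp (C * r)" by (simp add: C_def algebra_simps flip: exp_add)
      finally have T1: "exp (2 * K * r) * real n ^ 3 * D \<le> real T" using T by linarith
      \<comment> \<open>\<open>y\<close> is the Hoeffding exponent. It is at least
        \<open>2 * n /\<close>\<delta>, and \<open>y * exp (- y) <= 1\<close> then bounds
        \<open>2 * n * exp (- y)\<close> by \<delta>.\<close>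
      define y where "y = real T * \<epsilon>\<^sup>2 / 2"
      have y0: "y > 0" using T0 \<epsilon> by (simp add: y_def)
      have "exp (2 * K * r) * real n ^ 3 * D * \<epsilon>\<^sup>2 = 4 * real n / \<delta>"
      proof -
        obtain p where p: "1 - q = p" "p > 0" using assms by simp
        have "\<epsilon>\<^sup>2 = p\<^sup>2 / (real n)\<^sup>2 * exp (- (2 * K * r))"
          by (simp add: \<epsilon>_def p power_mult_distrib power_divide flip: exp_of_nat_mult)
        then show ?thesis
          using assms(3) p(2) n unfolding D_def p(1) by (simp add: exp_minus field_simps power2_eq_square power3_eq_cube)
      qed
      then have "4 * real n / \<delta> \<le> 2 * y"
        using mult_right_mono[OF T1, of "\<epsilon>\<^sup>2"] by (simp add: y_def)
      then have ny: "2 * real n \<le> \<delta> * y" using assms by (simp add: field_simps)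
      have "y * exp (- y) \<le> 1"
        using order_trans[OF _ exp_ge_add_one_self, of y y] by (simp add: exp_minus field_simps)
      then have "\<delta> * y * exp (- y) \<le> \<delta>"
        using assms mult_left_mono[of "y * exp (- y)" 1 \<delta>] by (simp add: mult_ac)
      moreover have "2 * real n * exp (- y) \<le> \<delta> * y * exp (- y)"
        using ny by (intro mult_right_mono) auto
      moreover have "2 * real T * (\<epsilon> / 2)\<^sup>2 = y" by (simp add: y_def power_divide)
      ultimately have "2 * real n * exp (- (2 * real T * (\<epsilon> / 2)\<^sup>2)) \<le> \<delta>"
        by (metis order_trans)
      then show ?thesis by (simp only: mult_ac)
    qed
    define freq where "freq ys j = real (length (filter (\<lambda>y. j < length y \<and> y ! j) ys)) / real T"
      for ys :: "bool list list" and j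
    \<comment> \<open>Half the separation \<epsilon> as tolerance: two distinct strings cannot both
      fit the same frequencies.\<close>
    define good where "good ys x \<longleftrightarrow> length x = n \<and> (\<forall>j<n. \<bar>freq ys j - trace_bit_prob q x j\<bar> < \<epsilon> / 2)"
      for ys x
    \<comment> \<open>The default value only secures output length \<open>n\<close> when no string
      fits.\<close>
    define X where "X ys = (if \<exists>x. good ys x then SOME x. good ys x else replicate n False)" for ys
    have unique: "x = y" if "good ys x" "good ys y" for ys x y
    proof (rule ccontr)
      assume "x \<noteq> y"
      then obtain j where "j < n" "\<epsilon> \<le> \<bar>trace_bit_prob q x j - trace_bit_prob q y j\<bar>"
        using sep \<open>good ys x\<close> \<open>good ys y\<close> unfolding good_def by blast
      moreover from this have "\<bar>freq ys j - trace_bit_prob q x j\<bar> < \<epsilon> / 2" "\<bar>freq ys j - trace_bit_prob q y j\<bar> < \<epsilon> / 2"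
        using that by (auto simp: good_def)
      ultimately show False by linarith
    qed
    have X: "X ys = x" if "good ys x" for ys x
      using that unique someI[of "good ys" x] by (auto simp: X_def)
    have "length (X ys) = n" for ys
    proof (cases "\<exists>x. good ys x")
      case True
      then show ?thesis using X by (metis good_def)
    qed (simp add: X_def)
    moreover have "1 - \<delta> \<le> measure_pmf.prob (deletion_traces q T x) {ys. X ys = x}"
      if x: "length x = n" for x
    proof -
      let ?P = "measure_pmf.prob (deletion_traces q T x)"
      define bad where "bad j = {ys. \<epsilon> / 2 \<le> \<bar>freq ys j - trace_bit_prob q x j\<bar>}" for j
      \<comment> \<open>A wrong estimate forces \<open>x\<close> not to be good, hence a deviation
        at some position; the union bound over the \<open>n\<close> positions follows.\<close>
      have "?P {ys. X ys \<noteq> x} \<le> ?P (\<Union>j<n. bad j)"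
        using X x by (intro measure_pmf.finite_measure_mono) (force simp: bad_def good_def not_le)+
      also have "\<dots> \<le> (\<Sum>j<n. ?P (bad j))"
        by (intro measure_pmf.finite_measure_subadditive_finite) auto
      also have "\<dots> \<le> (\<Sum>j<n. 2 * exp (- (2 * real T * (\<epsilon> / 2)\<^sup>2)))"
        unfolding bad_def freq_def trace_bit_prob_def deletion_traces_def
        using T0 \<epsilon> by (intro sum_mono replicate_pmf_frequency_tail) auto
      also have "\<dots> \<le> \<delta>" using fail by simp
      finally show ?thesis
        using measure_pmf.prob_compl[of "{ys. X ys = x}" "deletion_traces q T x"]
        by (simp add: Compl_eq_Diff_UNIV[symmetric] Collect_neg_eq)
    qed
    ultimately show ?thesis
      unfolding T_def by blast
  qed
  then show ?thesis by blast
qed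

end
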